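(* For every integer $j\ge 1$ and every integer $n\ge 0$, $$2\left(\frac{L_j}{2}\right)^{n+1}\frac{F_{jn}}{F_j}+2(-1)^{jn}=\sum_{i=0}^{n}(-1)^{j(n+i)}\left(\frac{L_j}{2}\right)^{i}L_{ji}.$$
   Context: $F_n$ denotes the Fibonacci numbers: $F_0=0$, $F_1=1$, $F_n=F_{n-1}+F_{n-2}$. $L_n$ denotes the Lucas numbers: $L_0=2$, $L_1=1$, $L_n=L_{n-1}+L_{n-2}$. *)

theory Defs
  imports Complex_Main "HOL-Number_Theory.Fib"
begin

fun lucas :: "nat \<Rightarrow> nat" where
  "lucas 0 = 2"
| "lucas (Suc 0) = 1"
| "lucas (Suc (Suc n)) = lucas (Suc n) + lucas n"

end

theory Submission
  imports Defs
begin

text \<open>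
  Write \<open>s = (-1) ^ j\<close> and \<open>x = L\<^sub>j / 2\<close>. The sums for consecutive \<open>n\<close> are linked by a first-order
  recurrence: passing from \<open>n\<close> to \<open>n + 1\<close> multiplies every old summand by \<open>s\<close> and adds the new summand
  \<open>x ^ (n + 1) L\<^bsub>j(n+1)\<^esub>\<close>, whose sign \<open>s ^ (2 (n + 1))\<close> is positive. The left-hand side satisfies
  the same recurrence precisely when \<open>L\<^sub>j F\<^sub>m - F\<^sub>j L\<^sub>m = 2 s F\<^bsub>m-j\<^esub>\<close> for \<open>m = j (n + 1)\<close>
  (\<open>fib_lucas_cross\<close>). Since \<open>L\<^sub>n = 2 F\<^bsub>n+1\<^esub> - F\<^sub>n\<close>, that identity is twice d'Ocagne's identity
  \<open>F\<^sub>m F\<^bsub>j+1\<^esub> - F\<^sub>j F\<^bsub>m+1\<^esub> = (-1) ^ j F\<^bsub>m-j\<^esub>\<close> (\<open>fib_dOcagne\<close>), so the theorem follows by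
  induction on \<open>n\<close>.
\<close>

lemma lucas_eq_fib: "real (lucas n) = 2 * real (fib (Suc n)) - real (fib n)"
  by (induction n rule: lucas.induct) simp_all

text \<open>
  The left-hand side is the determinant of two consecutive pairs of Fibonacci numbers. Shifting both
  pairs by one step multiplies it by the determinant \<open>-1\<close> of the Fibonacci matrix; at \<open>j = 0\<close> it is
  \<open>F\<^sub>k\<close>.
\<close>

lemma fib_dOcagne:
  "real (fib (k + j)) * real (fib (Suc j)) - real (fib j) * real (fib (Suc (k + j)))
    = (-1) ^ j * real (fib k)"
proof (induction j)
  case 0
  show ?case by simp
next
  case (Suc j)
  then show ?case by (simp add: algebra_simps)
qed

lemma fib_lucas_cross:
  "real (lucas j) * real (fib (k + j)) - real (fib j) * real (lucas (k + j))
    = 2 * (-1) ^ j * real (fib k)"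
  using fib_dOcagne[of k j] by (simp add: lucas_eq_fib algebra_simps)

theorem theorem4:
  fixes j n :: nat
  assumes "j \<ge> 1"
  shows "2 * (real (lucas j) / 2) ^ (n + 1) * (real (fib (j * n)) / real (fib j)) + 2 * (-1) ^ (j * n)
    = (\<Sum>i=0..n. (-1) ^ (j * (n + i)) * (real (lucas j) / 2) ^ i * real (lucas (j * i)))"
proof (induction n)
  case 0
  show ?case by simp
next
  case (Suc n)
  define x where "x = real (lucas j) / 2"
  define s :: real where "s = (-1) ^ j"
  define U where "U m = real (fib (j * m)) / real (fib j)" for m
  define S where "S m = (\<Sum>i=0..m. (-1) ^ (j * (m + i)) * x ^ i * real (lucas (j * i)))" for m
  have IH: "2 * x ^ (n + 1) * U n + 2 * s ^ n = S n"
    using Suc by (simp add: x_def s_def U_def S_def power_mult)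
  have "fib j > 0"
    using assms by (simp add: fib_neq_0_nat)
  then have U_step: "2 * x * U (Suc n) = 2 * s * U n + real (lucas (j * Suc n))"
    using fib_lucas_cross[of j "j * n"] by (simp add: x_def s_def U_def field_simps)
  have last_sign: "(-1 :: real) ^ (j * (Suc n + Suc n)) = 1"
    by simp
  have old_signs: "(-1 :: real) ^ (j * (Suc n + i)) = s * (-1) ^ (j * (n + i))" for i
    by (simp add: s_def flip: power_add)
  have "S (Suc n) = (\<Sum>i=0..n. (-1) ^ (j * (Suc n + i)) * x ^ i * real (lucas (j * i)))
      + x ^ Suc n * real (lucas (j * Suc n))"
    unfolding S_def sum.atLeast0_atMost_Suc last_sign by simp
  also have "\<dots> = s * S n + x ^ Suc n * real (lucas (j * Suc n))"
    unfolding S_def old_signs by (simp only: sum_distrib_left mult.assoc)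
  also have "\<dots> = s * (2 * x ^ (n + 1) * U n + 2 * s ^ n)
      + x ^ Suc n * (2 * x * U (Suc n) - 2 * s * U n)"
    using IH U_step by simp
  also have "\<dots> = 2 * x ^ (Suc n + 1) * U (Suc n) + 2 * s ^ Suc n"
    by (simp add: algebra_simps)
  finally show ?case
    by (simp add: x_def s_def U_def S_def power_mult power_add)
qed

end
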